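(* Let $(\underline P,\overline P)$ be a Vertical Barrier Model on $\mathcal A(\mathbb P)$. Let $\mathcal B\subset\mathcal A(\mathbb P)\setminus\{\emptyset\}$ be a finite partition with $|\mathcal B|\ge 3$ that weakly dilates a non-extreme event $A\in\mathcal A(\mathbb P)$, and such that $\underline P(B)>0$ for all $B\in\mathcal B$. Suppose further that the following (a) and (b) both hold: (a) one of the following applies: (a1) $\underline P(A)=0$; (a2) for all $B\in\mathcal B$, $\underline P(A\wedge B)>0$ and $\overline P(A^{\mathsf c}\wedge B)>0$; (b) one of the following applies: (b1) $\overline P(A)=1$; (b2) for all $B\in\mathcal B$, $\underline P(A^{\mathsf c}\wedge B)>0$ and $\overline P(A\wedge B)>0$. Then there is a non-trivial partition (i.e. different from $\{\Omega\}$), coarser than $\mathcal B$ and different from $\mathcal B$, that weakly dilates $A$.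
   Context: Let $\mathbb P$ be a partition (finite or infinite) of the sure event $\Omega$ and $\mathcal A(\mathbb P)$ the set of events logically dependent on $\mathbb P$, i.e. (identifying events with sets) the power set of $\mathbb P$, with $\Omega$ the whole set, $\emptyset$ the impossible event, $\wedge,\vee,{}^{\mathsf c}$ intersection, union and complement. A partition $\mathcal B\subset\mathcal A(\mathbb P)\setminus\{\emptyset\}$ is a family of pairwise disjoint non-empty events whose union is $\Omega$; a partition $\mathcal B'$ is coarser than $\mathcal B$ if each element of $\mathcal B'$ is a union of elements of $\mathcal B$. "Probability" means finitely additive probability on $\mathcal A(\mathbb P)$. Vertical Barrier Model (VBM): given a probability $P_0$ on $\mathcal A(\mathbb P)$ and $b>0$, $a\le 0$ with $0\le a+b\le 1$, and $c=1-(a+b)$, put $\underline P(A)=\max\{bP_0(A)+a,0\}$ for $A\ne\Omega$, $\underline P(\Omega)=1$; $\overline P(A)=\min\{bP_0(A)+c,1\}$ for $A\ne\emptyset$, $\overline P(\emptyset)=0$. Natural extension: let $\mathcal M=\{P \text{ probability on }\mathcal A(\mathbb P): P\ge\underline P\}$. For $B\ne\emptyset$, let $\mathcal M_B$ be the set of pairs $(P,P(\cdot|B))$ with $P\in\mathcal M$ and $P(\cdot|B)$ a probability on $\mathcal A(\mathbb P)$ satisfying $P(B|B)=1$ and $P(A\wedge B)=P(A|B)P(B)$ for all $A\in\mathcal A(\mathbb P)$. Then $\underline E(A|B)=\inf_{\mathcal M_B}P(A|B)$ and $\overline E(A|B)=\sup_{\mathcal M_B}P(A|B)$. $\mathcal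 B$ weakly dilates $A$ if $\underline E(A|B)\le\underline P(A)\le\overline P(A)\le\overline E(A|B)$ for all $B\in\mathcal B$. $A$ is extreme if $\underline P(A)=\overline P(A)=0$ or $\underline P(A)=\overline P(A)=1$. *)

theory Defs
  imports Complex_Main "HOL-Library.Disjoint_Sets"
begin

text \<open>
  The atoms of the underlying (finite or infinite) partition of the sure event are the elements
  of the type \<open>'w\<close>. The events logically dependent on it are all sets of type \<open>'w set\<close>; the sure
  event is \<open>UNIV\<close>.
\<close>

definition fa_prob :: "('w set \<Rightarrow> real) \<Rightarrow> bool" where
  "fa_prob P \<longleftrightarrow>
     (\<forall>A. 0 \<le> P A) \<and> P UNIV = 1 \<and>
     (\<forall>A B. A \<inter> B = {} \<longrightarrow> P (A \<union> B) = P A + P B)"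

definition vbm_lower :: "('w set \<Rightarrow> real) \<Rightarrow> real \<Rightarrow> real \<Rightarrow> 'w set \<Rightarrow> real" where
  "vbm_lower P0 a b A = (if A = UNIV then 1 else max (b * P0 A + a) 0)"

definition vbm_upper :: "('w set \<Rightarrow> real) \<Rightarrow> real \<Rightarrow> real \<Rightarrow> 'w set \<Rightarrow> real" where
  "vbm_upper P0 a b A = (if A = {} then 0 else min (b * P0 A + (1 - (a + b))) 1)"

definition vertical_barrier_model :: "('w set \<Rightarrow> real) \<Rightarrow> ('w set \<Rightarrow> real) \<Rightarrow> bool" where
  "vertical_barrier_model L U \<longleftrightarrow>
     (\<exists>P0 a b. fa_prob P0 \<and> 0 < b \<and> a \<le> 0 \<and> 0 \<le> a + b \<and> a + b \<le> 1 \<and>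
        L = vbm_lower P0 a b \<and> U = vbm_upper P0 a b)"

definition credal_set :: "('w set \<Rightarrow> real) \<Rightarrow> ('w set \<Rightarrow> real) set" where
  "credal_set L = {P. fa_prob P \<and> (\<forall>A. L A \<le> P A)}"

text \<open>
  A pair \<open>(P, Q)\<close> consists of an unconditional probability \<open>P\<close> and a conditional probability
  \<open>Q = P(\<cdot>|B)\<close>. If \<open>P B = 0\<close>, the product rule does not constrain \<open>Q\<close>, as intended.
\<close>

definition conditional_pairs ::
    "('w set \<Rightarrow> real) \<Rightarrow> 'w set \<Rightarrow> (('w set \<Rightarrow> real) \<times> ('w set \<Rightarrow> real)) set" where
  "conditional_pairs L B =
     {(P, Q). P \<in> credal_set L \<and> fa_prob Q \<and> Q B = 1 \<and> (\<forall>A. P (A \<inter> B) = Q A * P B)}"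

text \<open>
  The real-valued infimum and supremum are the intended ones for \<open>B \<noteq> {}\<close> and \<open>L\<close> from a
  Vertical Barrier Model: the values lie in \<open>[0, 1]\<close>, and \<open>P0\<close> itself belongs to the credal set
  (as \<open>b * P0 A + a \<le> P0 A\<close>), so there is at least one conditional pair.
\<close>

definition lower_ext :: "('w set \<Rightarrow> real) \<Rightarrow> 'w set \<Rightarrow> 'w set \<Rightarrow> real" where
  "lower_ext L A B = (INF (P, Q) \<in> conditional_pairs L B. Q A)"

definition upper_ext :: "('w set \<Rightarrow> real) \<Rightarrow> 'w set \<Rightarrow> 'w set \<Rightarrow> real" where
  "upper_ext L A B = (SUP (P, Q) \<in> conditional_pairs L B. Q A)"

definition weakly_dilates ::
    "('w set \<Rightarrow> real) \<Rightarrow> ('w set \<Rightarrow> real) \<Rightarrow> 'w set set \<Rightarrow> 'w set \<Rightarrow> bool" where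
  "weakly_dilates L U \<B> A \<longleftrightarrow>
     (\<forall>B\<in>\<B>. lower_ext L A B \<le> L A \<and> L A \<le> U A \<and> U A \<le> upper_ext L A B)"

definition extreme_event ::
    "('w set \<Rightarrow> real) \<Rightarrow> ('w set \<Rightarrow> real) \<Rightarrow> 'w set \<Rightarrow> bool" where
  "extreme_event L U A \<longleftrightarrow> (L A = 0 \<and> U A = 0) \<or> (L A = 1 \<and> U A = 1)"

definition coarser :: "'w set set \<Rightarrow> 'w set set \<Rightarrow> bool" where
  "coarser \<B>' \<B> \<longleftrightarrow> (\<forall>C\<in>\<B>'. \<exists>\<S>\<subseteq>\<B>. C = \<Union>\<S>)"

end

theory Submission
  imports Defs
begin

text \<open>
  Write \<open>\<lambda> = L A > 0\<close> and \<open>f C = b (P0 (A \<inter> C) - \<lambda> P0 C)\<close>, which is additive in \<open>C\<close>. Under (a2) the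
  natural extension is explicit, and the dilation inequality \<open>E(A|C) \<le> L A\<close> becomes \<open>f C \<le> K\<close>
  with \<open>K = \<lambda> (1 - b) - a \<ge> 0\<close>. The point is that \<open>f UNIV = K\<close>, so the values of \<open>f\<close> on the cells
  sum to \<open>K\<close>. Under (a1) the inequality holds for every union of cells, so \<open>f = K = 0\<close> will do.
  Passing to \<open>- A\<close>, the upper inequality is governed by a second function \<open>g\<close> with bound \<open>K'\<close>.
  If \<open>f\<close> and \<open>g\<close> are both nonnegative on some cell, then merging all other cells works. Otherwise
  there are a cell with \<open>f \<ge> 0 > g\<close> and a cell with \<open>g \<ge> 0 > f\<close>, and these two can be merged.
\<close>

section \<open>Finitely additive probabilities\<close>

lemma fa_prob_nonneg: "fa_prob P \<Longrightarrow> 0 \<le> P A"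
  and fa_prob_UNIV: "fa_prob P \<Longrightarrow> P UNIV = 1"
  and fa_prob_Un: "fa_prob P \<Longrightarrow> A \<inter> B = {} \<Longrightarrow> P (A \<union> B) = P A + P B"
  by (simp_all add: fa_prob_def)

lemma fa_prob_empty: "fa_prob P \<Longrightarrow> P {} = 0"
  using fa_prob_Un[of P "{}" "{}"] by simp

lemma fa_prob_split: "fa_prob P \<Longrightarrow> P B = P (A \<inter> B) + P (- A \<inter> B)"
  using fa_prob_Un[of P "A \<inter> B" "- A \<inter> B"] Int_Un_distrib2[of A "- A" B] by auto

lemma fa_prob_compl: "fa_prob P \<Longrightarrow> P (- A) = 1 - P A"
  using fa_prob_split[of P UNIV A] by (simp add: fa_prob_UNIV)

lemma fa_prob_mono:
  assumes "fa_prob P" "A \<subseteq> B"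
  shows "P A \<le> P B"
  using fa_prob_split[of P B A] fa_prob_nonneg[of P "- A \<inter> B"] assms
  by (simp add: Int_absorb2)

lemma fa_prob_le_1: "fa_prob P \<Longrightarrow> P A \<le> 1"
  using fa_prob_mono[of P A UNIV] by (simp add: fa_prob_UNIV)

lemma fa_prob_Union:
  assumes "fa_prob P" "finite S" "disjoint S"
  shows "P (A \<inter> \<Union>S) = (\<Sum>B\<in>S. P (A \<inter> B))"
  using assms(2,3)
proof (induction S rule: finite_induct)
  case empty
  then show ?case using fa_prob_empty[OF assms(1)] by simp
next
  case (insert B S)
  then have "(A \<inter> B) \<inter> (A \<inter> \<Union>S) = {}"
    by (auto simp: disjoint_def)
  with insert show ?case
    using fa_prob_Un[OF assms(1)] by (simp add: Int_Un_distrib pairwise_insert)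
qed

lemma fa_prob_conditional:
  assumes "fa_prob P" "P B > 0"
  shows "fa_prob (\<lambda>A. P (A \<inter> B) / P B)"
proof -
  have "P ((A \<union> C) \<inter> B) = P (A \<inter> B) + P (C \<inter> B)" if "A \<inter> C = {}" for A C
    using that fa_prob_Un[OF assms(1), of "A \<inter> B" "C \<inter> B"] by (auto simp: Int_Un_distrib2)
  then show ?thesis
    using assms by (simp add: fa_prob_def add_divide_distrib)
qed

section \<open>Conditional probabilities and natural extensions\<close>

lemma conditional_pairs_conditional:
  assumes "P \<in> credal_set L" "P B > 0"
  shows "(P, \<lambda>A. P (A \<inter> B) / P B) \<in> conditional_pairs L B"
  using assms fa_prob_conditional[of P B] by (simp add: conditional_pairs_def credal_set_def)

lemma conditional_pairs_fa_prob: "(P, Q) \<in> conditional_pairs L B \<Longrightarrow> fa_prob Q"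
  by (simp add: conditional_pairs_def)

lemma lower_ext_le:
  assumes "(P, Q) \<in> conditional_pairs L B"
  shows "lower_ext L A B \<le> Q A"
proof -
  have "bdd_below ((\<lambda>(P, Q). Q A) ` conditional_pairs L B)"
    by (rule bdd_belowI[of _ 0]) (auto dest!: conditional_pairs_fa_prob intro: fa_prob_nonneg)
  from cINF_lower[OF this assms] show ?thesis by (simp add: lower_ext_def)
qed

lemma upper_ext_ge:
  assumes "(P, Q) \<in> conditional_pairs L B"
  shows "Q A \<le> upper_ext L A B"
proof -
  have "bdd_above ((\<lambda>(P, Q). Q A) ` conditional_pairs L B)"
    by (rule bdd_aboveI[of _ 1]) (auto dest!: conditional_pairs_fa_prob intro: fa_prob_le_1)
  from cSUP_upper[OF assms this] show ?thesis by (simp add: upper_ext_def)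
qed

text \<open>Each pair satisfies \<open>Q A = 1 - Q (- A)\<close>, so supremum and infimum swap. This
  turns the upper half of dilation of \<open>A\<close> into the lower half for
  \<open>- A\<close>.\<close>

lemma upper_ext_compl:
  assumes "conditional_pairs L B \<noteq> {}"
  shows "upper_ext L A B = 1 - lower_ext L (- A) B"
proof (rule antisym)
  have "Q A \<le> 1 - lower_ext L (- A) B" if "(P, Q) \<in> conditional_pairs L B" for P Q
    using lower_ext_le[OF that, of "- A"] conditional_pairs_fa_prob[OF that]
    by (simp add: fa_prob_compl)
  then show "upper_ext L A B \<le> 1 - lower_ext L (- A) B"
    unfolding upper_ext_def by (intro cSUP_least assms) auto
  have "1 - upper_ext L A B \<le> Q (- A)" if "(P, Q) \<in> conditional_pairs L B" for P Q
    using upper_ext_ge[OF that, of A] conditional_pairs_fa_prob[OF that]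
    by (simp add: fa_prob_compl)
  then have "1 - upper_ext L A B \<le> lower_ext L (- A) B"
    unfolding lower_ext_def by (intro cINF_greatest assms) auto
  then show "1 - lower_ext L (- A) B \<le> upper_ext L A B" by simp
qed

section \<open>Merging cells of a partition\<close>

text \<open>A cell outside \<open>S\<close> keeps the result from being \<open>{UNIV}\<close>; two
  distinct members of \<open>S\<close> keep it different from \<open>\<B>\<close>.\<close>

lemma partition_on_merge:
  assumes \<B>: "partition_on UNIV \<B>" and S: "S \<subset> \<B>" "card S \<ge> 2"
  defines "\<B>' \<equiv> insert (\<Union>S) (\<B> - S)"
  shows "partition_on UNIV \<B>'" "\<B>' \<noteq> {UNIV}" "coarser \<B>' \<B>" "\<B>' \<noteq> \<B>"
proof -
  have disj: "B \<inter> C = {}" if "B \<in> \<B>" "C \<in> \<B>" "B \<noteq> C" for B C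
    using partition_onD2[OF \<B>] that by (auto simp: disjoint_def)
  have nonempty: "B \<noteq> {}" if "B \<in> \<B>" for B
    using partition_onD3[OF \<B>] that by auto
  have rest: "B \<inter> \<Union>S = {}" if "B \<in> \<B> - S" for B
    using disj that S(1) by blast
  obtain T where "T \<subseteq> S" "card T = 2"
    using obtain_subset_with_card_n[OF S(2)] by metis
  then obtain B1 B2 where B12: "B1 \<in> S" "B2 \<in> S" "B1 \<noteq> B2"
    by (auto simp: card_2_iff)
  obtain B3 where B3: "B3 \<in> \<B> - S" using S(1) by blast
  have "\<Union>S \<noteq> {}"
    using B12 S(1) nonempty by blast
  moreover have "\<Union>S \<union> \<Union>(\<B> - S) = UNIV"
    using partition_onD1[OF \<B>] S(1) by blast
  ultimately show "partition_on UNIV \<B>'"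
    using nonempty disj rest unfolding \<B>'_def partition_on_def disjoint_def
    by (auto simp: Int_commute)
  show "\<B>' \<noteq> {UNIV}"
    using B3 rest[OF B3] \<open>\<Union>S \<noteq> {}\<close> unfolding \<B>'_def by (auto dest!: equalityD1)
  show "coarser \<B>' \<B>"
    unfolding coarser_def \<B>'_def
  proof
    fix C assume "C \<in> insert (\<Union>S) (\<B> - S)"
    then show "\<exists>\<S>\<subseteq>\<B>. C = \<Union>\<S>"
    proof
      assume "C \<in> \<B> - S"
      then show ?thesis by (intro exI[of _ "{C}"]) simp
    qed (use S(1) in blast)
  qed
  have "\<Union>S \<notin> \<B>"
  proof
    assume "\<Union>S \<in> \<B>"
    \<comment> \<open>Each nonempty member of \<open>S\<close> meets the cell
      \<open>\<Union>S\<close>, hence equals it.\<close>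
    then have "B = \<Union>S" if "B \<in> S" for B
      using disj[of B "\<Union>S"] nonempty[of B] that S(1) by blast
    with B12 show False by metis
  qed
  then show "\<B>' \<noteq> \<B>" unfolding \<B>'_def by blast
qed

text \<open>Dropping a nonnegative term from the total, or adding a negative one to a single term,
  stays below the total. With three indices, \<open>I - {i}\<close> has two elements and
  \<open>{i, j}\<close> is proper.\<close>

lemma merge_two_bounds:
  fixes f g :: "'a \<Rightarrow> real"
  assumes "finite I" "card I \<ge> 3"
    and f: "0 \<le> sum f I" "\<forall>i\<in>I. f i \<le> sum f I"
    and g: "0 \<le> sum g I" "\<forall>i\<in>I. g i \<le> sum g I"
  shows "\<exists>S\<subset>I. card S \<ge> 2 \<and> sum f S \<le> sum f I \<and> sum g S \<le> sum g I"
proof (cases "\<exists>i\<in>I. f i \<ge> 0 \<and> g i \<ge> 0")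
  case True
  then obtain i where "i \<in> I" "f i \<ge> 0" "g i \<ge> 0" by blast
  with assms(1,2) show ?thesis
    by (intro exI[of _ "I - {i}"]) (auto simp: sum_diff1)
next
  case False
  have ex_nonneg: "\<exists>i\<in>I. h i \<ge> 0" if "0 \<le> sum h I" for h :: "'a \<Rightarrow> real"
  proof (rule ccontr)
    assume "\<not> ?thesis"
    then have "sum h I < 0"
      using assms(1,2) sum_strict_mono[of I h "\<lambda>_. 0"] by (force simp: not_le)
    with that show False by simp
  qed
  obtain i j where ij: "i \<in> I" "f i \<ge> 0" "j \<in> I" "g j \<ge> 0"
    using ex_nonneg[OF f(1)] ex_nonneg[OF g(1)] by blast
  with False have neg: "g i < 0" "f j < 0" by (auto simp: not_le)
  with ij have "i \<noteq> j" by auto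
  moreover have "{i, j} \<noteq> I"
  proof
    assume "{i, j} = I"
    then have "card I \<le> 2" using card_insert_le_m1[of 2 "{j}" i] by simp
    with assms(2) show False by simp
  qed
  ultimately show ?thesis
    using ij neg bspec[OF f(2) ij(1)] bspec[OF g(2) ij(3)] by (intro exI[of _ "{i, j}"]) auto
qed

section \<open>The credal set of a Vertical Barrier Model\<close>

locale vbm =
  fixes P0 :: "'w set \<Rightarrow> real" and a b :: real
  assumes P0: "fa_prob P0"
    and b_nonneg: "0 \<le> b" and a_nonpos: "a \<le> 0" and ab_nonneg: "0 \<le> a + b" and ab_le: "a + b \<le> 1"
begin

abbreviation "L \<equiv> vbm_lower P0 a b"
abbreviation "U \<equiv> vbm_upper P0 a b"

text \<open>At \<open>UNIV\<close>, where \<open>L\<close> is set to 1, \<open>a + b \<le> 1\<close>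
  gives the bound, so one affine formula covers all events.\<close>

lemma affine_le_credal:
  assumes "P \<in> credal_set L"
  shows "b * P0 Z + a \<le> P Z"
proof (cases "Z = UNIV")
  case True
  with assms ab_le show ?thesis by (simp add: credal_set_def fa_prob_UNIV P0)
next
  case False
  have "L Z \<le> P Z" using assms by (simp add: credal_set_def)
  with False show ?thesis by (simp add: vbm_lower_def)
qed

lemma credal_le_affine:
  assumes "P \<in> credal_set L"
  shows "P Z \<le> b * P0 Z + (1 - (a + b))"
proof -
  have "fa_prob P" using assms by (simp add: credal_set_def)
  with affine_le_credal[OF assms, of "- Z"] show ?thesis
    by (simp add: fa_prob_compl P0 algebra_simps)
qed

lemma P0_in_credal: "P0 \<in> credal_set L"
proof -
  have "b * P0 Z + a \<le> P0 Z" for Z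
  \<comment> \<open>\<open>P0 Z - (b * P0 Z + a)\<close> is affine in \<open>P0 Z\<close>; the sign
    of \<open>1 - b\<close> decides whether it is smallest at 0 or at 1.\<close>
  proof (cases "b \<le> 1")
    case True
    then have "b * P0 Z \<le> 1 * P0 Z"
      by (intro mult_right_mono) (auto simp: fa_prob_nonneg P0)
    with a_nonpos show ?thesis by simp
  next
    case False
    then have "(b - 1) * P0 Z \<le> b - 1"
      by (intro mult_left_le) (auto simp: fa_prob_le_1 P0)
    with ab_le show ?thesis by (simp add: algebra_simps)
  qed
  then show ?thesis
    by (simp add: credal_set_def vbm_lower_def P0 fa_prob_UNIV fa_prob_nonneg)
qed

lemma vbm_upper_compl: "U Z = 1 - L (- Z)"
  by (auto simp: vbm_upper_def vbm_lower_def fa_prob_compl P0 algebra_simps min_def max_def)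

text \<open>
  From \<open>b P0\<close>, of total mass \<open>b\<close>, mass \<open>- a\<close> is removed, at different rates on \<open>X\<close> and on \<open>- X\<close>,
  and a point mass \<open>1 - (a + b)\<close> is added at \<open>y\<close>. No event then loses more than \<open>- a\<close>.
\<close>

definition transfer :: "'w set \<Rightarrow> real \<Rightarrow> real \<Rightarrow> 'w \<Rightarrow> 'w set \<Rightarrow> real" where
  "transfer X s t y Z =
     s * P0 (Z \<inter> X) + t * P0 (Z \<inter> - X) + (1 - (a + b)) * of_bool (y \<in> Z)"

lemma transfer_in_credal:
  assumes s: "0 \<le> s" "s \<le> b" and t: "0 \<le> t" "t \<le> b"
    and mass: "s * P0 X + t * P0 (- X) = a + b"
  shows "transfer X s t y \<in> credal_set L"
proof -
  let ?P = "transfer X s t y"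
  have nonneg: "0 \<le> ?P Z" for Z
    using s t ab_le by (simp add: transfer_def fa_prob_nonneg P0)
  have UNIV: "?P UNIV = 1"
    using mass by (simp add: transfer_def)
  have Un: "?P (Z \<union> W) = ?P Z + ?P W" if "Z \<inter> W = {}" for Z W
  proof -
    have "P0 ((Z \<union> W) \<inter> V) = P0 (Z \<inter> V) + P0 (W \<inter> V)" for V
      using that fa_prob_Un[OF P0, of "Z \<inter> V" "W \<inter> V"] by (auto simp: Int_Un_distrib2)
    with that show ?thesis by (auto simp: transfer_def algebra_simps)
  qed
  have "b * P0 Z + a \<le> ?P Z" for Z
  proof -
    \<comment> \<open>The removal rates \<open>b - s\<close> and \<open>b - t\<close> are
      nonnegative, so \<open>Z\<close> loses at most what the whole space loses.\<close>
    have "(b - s) * P0 (Z \<inter> X) + (b - t) * P0 (Z \<inter> - X) \<le> (b - s) * P0 X + (b - t) * P0 (- X)"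
      using s t by (intro add_mono mult_left_mono fa_prob_mono P0) auto
    also have "\<dots> = - a"
      using mass by (simp add: fa_prob_compl P0 algebra_simps)
    finally have "b * (P0 (X \<inter> Z) + P0 (- X \<inter> Z)) + a \<le> s * P0 (Z \<inter> X) + t * P0 (Z \<inter> - X)"
      by (simp add: algebra_simps Int_commute)
    also have "\<dots> \<le> ?P Z"
      using ab_le by (simp add: transfer_def)
    finally show ?thesis
      using fa_prob_split[OF P0, of Z X] by simp
  qed
  with nonneg UNIV Un show ?thesis
    by (auto simp: credal_set_def fa_prob_def vbm_lower_def)
qed

text \<open>All of the mass \<open>- a\<close> is taken from \<open>X\<close> and the point mass is
  placed in \<open>Y\<close>, so a single \<open>P\<close> meets the lower bound on \<open>X\<close>
  and the upper bound on \<open>Y\<close>.\<close>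

lemma credal_attains_bounds:
  assumes "0 < b * P0 X + a" and "X \<inter> Y = {}" and "Y \<noteq> {}"
  shows "\<exists>P\<in>credal_set L. P X = b * P0 X + a \<and> P Y = b * P0 Y + (1 - (a + b))"
proof -
  obtain y where y: "y \<in> Y" using assms(3) by blast
  define s where "s = (b * P0 X + a) / P0 X"
  have "P0 X \<noteq> 0" using assms(1) a_nonpos by auto
  then have pos: "0 < P0 X" using fa_prob_nonneg[OF P0, of X] by simp
  then have sX: "s * P0 X = b * P0 X + a" by (simp add: s_def)
  have s: "0 \<le> s" "s \<le> b"
    using pos assms(1) a_nonpos by (simp_all add: s_def divide_simps)
  have "transfer X s b y \<in> credal_set L"
    using s b_nonneg sX by (intro transfer_in_credal) (auto simp: fa_prob_compl P0 algebra_simps)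
  moreover have "transfer X s b y X = b * P0 X + a"
    using sX y assms(2) by (auto simp: transfer_def fa_prob_empty P0)
  moreover have "Y \<inter> X = {}" "Y \<inter> - X = Y" using assms(2) by auto
  then have "transfer X s b y Y = b * P0 Y + (1 - (a + b))"
    using y by (simp add: transfer_def fa_prob_empty P0)
  ultimately show ?thesis by blast
qed

text \<open>The mass \<open>b * P0 X\<close> is at most \<open>- a\<close>, so it can be removed
  entirely; the rest is taken from \<open>- X\<close>, and the point mass is placed outside
  \<open>X\<close>.\<close>

lemma credal_attains_zero:
  assumes "b * P0 X + a \<le> 0" and "X \<noteq> UNIV"
  shows "\<exists>P\<in>credal_set L. P X = 0"
proof -
  obtain y where y: "y \<notin> X" using assms(2) by blast
  define t where "t = (a + b) / P0 (- X)"
  have tX: "t * P0 (- X) = a + b"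
  \<comment> \<open>If \<open>P0 (- X) = 0\<close>, the hypothesis forces \<open>a + b = 0\<close>,
    which agrees with the default value 0 of \<open>t\<close>.\<close>
  proof (cases "P0 (- X) = 0")
    case True
    then have "P0 X = 1" by (simp add: fa_prob_compl P0)
    with assms(1) ab_nonneg True show ?thesis by simp
  qed (simp add: t_def)
  have nonneg: "0 \<le> P0 (- X)" by (simp add: fa_prob_nonneg P0)
  then have t_nonneg: "0 \<le> t" using ab_nonneg by (simp add: t_def)
  have "a + b \<le> b * P0 (- X)"
    using assms(1) by (simp add: fa_prob_compl P0 algebra_simps)
  then have "t \<le> b"
    using nonneg b_nonneg by (cases "P0 (- X) = 0") (auto simp: t_def divide_le_eq)
  then have "transfer X 0 t y \<in> credal_set L"
    using t_nonneg b_nonneg tX by (intro transfer_in_credal) auto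
  moreover have "transfer X 0 t y X = 0"
    using y by (simp add: transfer_def fa_prob_empty P0)
  ultimately show ?thesis by blast
qed

lemma credal_pos:
  assumes "P \<in> credal_set L" "0 < L B" "B \<subseteq> C"
  shows "0 < P C"
proof -
  have "fa_prob P" "L B \<le> P B" using assms(1) by (auto simp: credal_set_def)
  with fa_prob_mono[OF _ assms(3), of P] assms(2) show ?thesis by simp
qed

lemma conditional_pairs_nonempty:
  assumes "0 < L B" "B \<subseteq> C"
  shows "conditional_pairs L C \<noteq> {}"
  using conditional_pairs_conditional[OF P0_in_credal credal_pos[OF P0_in_credal assms]] by blast

section \<open>Dilation as an additive criterion\<close>

text \<open>A ratio \<open>x / (x + y)\<close> grows with \<open>x\<close> and falls with
  \<open>y\<close>, so the bounds \<open>u\<close> for \<open>P (A \<inter> B)\<close> and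
  \<open>v\<close> for \<open>P (- A \<inter> B)\<close> yield \<open>u / (u + v)\<close> as a lower
  bound for every conditional probability.\<close>

lemma lower_ext_leD:
  assumes le: "lower_ext L A B \<le> l" and LB: "0 < L B" and pos: "0 < b * P0 (A \<inter> B) + a"
    and l: "0 \<le> l" "l \<le> 1"
  shows "b * P0 (A \<inter> B) + a \<le> l * (b * P0 B + 1 - b)"
proof -
  define u where "u = b * P0 (A \<inter> B) + a"
  define v where "v = b * P0 (- A \<inter> B) + (1 - (a + b))"
  have u: "0 < u" using pos by (simp add: u_def)
  have v: "0 \<le> v" using b_nonneg ab_le by (simp add: v_def fa_prob_nonneg P0)
  have "u / (u + v) \<le> Q A" if "(P, Q) \<in> conditional_pairs L B" for P Q
  proof -
    have P: "P \<in> credal_set L" "P (A \<inter> B) = Q A * P B" and Q: "fa_prob Q"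
      using that by (auto simp: conditional_pairs_def)
    have "u \<le> P (A \<inter> B)" "P (- A \<inter> B) \<le> v"
      using affine_le_credal credal_le_affine P(1) by (auto simp: u_def v_def)
    moreover have "P B = P (A \<inter> B) + P (- A \<inter> B)"
      using P(1) fa_prob_split by (auto simp: credal_set_def)
    moreover have "(1 - Q A) * P B = P B - Q A * P B"
      by (simp add: left_diff_distrib)
    ultimately have 1: "Q A * P B \<ge> u" and 2: "(1 - Q A) * P B \<le> v"
      using P(2) by linarith+
    \<comment> \<open>The monotonicity of the ratio, cross-multiplied so that nothing is divided by
      \<open>P B\<close>.\<close>
    have "(1 - Q A) * u \<le> (1 - Q A) * (Q A * P B)"
      using 1 fa_prob_le_1[OF Q] by (intro mult_left_mono) auto
    also have "\<dots> = Q A * ((1 - Q A) * P B)" by simp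
    also have "\<dots> \<le> Q A * v"
      using 2 fa_prob_nonneg[OF Q] by (intro mult_left_mono) auto
    finally show ?thesis
      using u v by (simp add: divide_le_eq algebra_simps)
  qed
  then have "u / (u + v) \<le> lower_ext L A B"
    unfolding lower_ext_def
    using conditional_pairs_nonempty[OF LB order_refl] by (intro cINF_greatest) auto
  with le have "u / (u + v) \<le> l" by simp
  then have "u \<le> l * (u + v)"
    using u v by (simp add: divide_le_eq)
  also have "u + v = b * P0 B + 1 - b"
    using fa_prob_split[OF P0, of B A] by (simp add: u_def v_def algebra_simps)
  finally show ?thesis by (simp add: u_def)
qed

text \<open>The existential hides which alternative of \<open>cases\<close> holds, so the results
  for \<open>A\<close> and \<open>- A\<close> combine whichever alternatives apply.\<close>

lemma additive_dilation_criterion: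
  assumes \<B>: "partition_on UNIV \<B>" "finite \<B>" "\<B> \<noteq> {}" and LB: "\<forall>B\<in>\<B>. L B > 0"
    and A: "A \<noteq> UNIV"
    and dil: "\<forall>B\<in>\<B>. lower_ext L A B \<le> L A"
    and cases: "L A = 0 \<or> (\<forall>B\<in>\<B>. L (A \<inter> B) > 0 \<and> U (- A \<inter> B) > 0)"
  shows "\<exists>f :: 'w set \<Rightarrow> real. 0 \<le> sum f \<B> \<and> (\<forall>B\<in>\<B>. f B \<le> sum f \<B>) \<and>
    (\<forall>S\<subseteq>\<B>. S \<noteq> {} \<longrightarrow> sum f S \<le> sum f \<B> \<longrightarrow> lower_ext L A (\<Union>S) \<le> L A)"
  using cases
proof (elim disjE)
  assume L0: "L A = 0"
  have "lower_ext L A (\<Union>S) \<le> L A" if S: "S \<subseteq> \<B>" "S \<noteq> {}" for S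
  proof -
    \<comment> \<open>Some \<open>P\<close> vanishes on \<open>A \<inter> \<Union>S\<close> but not
      on \<open>\<Union>S\<close>; conditioning it gives \<open>A\<close> the value 0, which is
      \<open>L A\<close>.\<close>
    have "b * P0 (A \<inter> \<Union>S) \<le> b * P0 A"
      using b_nonneg by (intro mult_left_mono fa_prob_mono P0) auto
    moreover have "b * P0 A + a \<le> 0"
      using L0 A by (simp add: vbm_lower_def max_def split: if_splits)
    ultimately obtain P where P: "P \<in> credal_set L" "P (A \<inter> \<Union>S) = 0"
      using credal_attains_zero[of "A \<inter> \<Union>S"] A by force
    obtain B where "B \<in> S" using S(2) by blast
    with S(1) LB have "0 < P (\<Union>S)"
      using credal_pos[OF P(1), of B] by blast
    from lower_ext_le[OF conditional_pairs_conditional[OF P(1) this], of A] P(2) L0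
    show ?thesis by simp
  qed
  then show ?thesis by (intro exI[of _ "\<lambda>_. 0"]) auto
next
  assume pos: "\<forall>B\<in>\<B>. L (A \<inter> B) > 0 \<and> U (- A \<inter> B) > 0"
  define l where "l = L A"
  define f where "f B = b * (P0 (A \<inter> B) - l * P0 B)" for B
  \<comment> \<open>Positive upper probability enters as nonemptiness: it provides a place in
    \<open>- A \<inter> B\<close> for the point mass.\<close>
  have cell: "0 < b * P0 (A \<inter> B) + a" "- A \<inter> B \<noteq> {}" if "B \<in> \<B>" for B
  proof -
    have "A \<inter> B \<noteq> UNIV" using A by blast
    with pos that show "0 < b * P0 (A \<inter> B) + a"
      by (auto simp: vbm_lower_def max_def split: if_splits)
    show "- A \<inter> B \<noteq> {}"
      using pos that by (auto simp: vbm_upper_def split: if_splits)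
  qed
  have union: "0 < b * P0 (A \<inter> C) + a" if "B \<in> \<B>" "B \<subseteq> C" for B C
  proof -
    have "b * P0 (A \<inter> B) \<le> b * P0 (A \<inter> C)"
      using b_nonneg that(2) by (intro mult_left_mono fa_prob_mono P0) auto
    with cell(1)[OF that(1)] show ?thesis by simp
  qed
  obtain B0 where "B0 \<in> \<B>" using \<B>(3) by blast
  from union[OF this, of UNIV] A have l: "l = b * P0 A + a" "0 < l"
    by (simp_all add: l_def vbm_lower_def)
  have "b * P0 A \<le> b * 1"
    using b_nonneg by (intro mult_left_mono fa_prob_le_1 P0)
  with l ab_le have l1: "l \<le> 1" by simp
  have sum_f: "sum f S = b * (P0 (A \<inter> \<Union>S) - l * P0 (\<Union>S))" if "S \<subseteq> \<B>" for S
  proof -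
    have S: "finite S" "disjoint S"
      using that \<B>(2) partition_onD2[OF \<B>(1)] by (auto intro: finite_subset pairwise_subset)
    have "sum f S = b * ((\<Sum>B\<in>S. P0 (A \<inter> B)) - l * (\<Sum>B\<in>S. P0 (UNIV \<inter> B)))"
      by (simp add: f_def sum_subtractf sum_distrib_left right_diff_distrib)
    with S show ?thesis
      by (simp only: fa_prob_Union[OF P0 S, symmetric]) simp
  qed
  have "sum f \<B> = b * (P0 A - l)"
    using sum_f[of \<B>] partition_onD1[OF \<B>(1)] by (simp add: fa_prob_UNIV P0)
  also have "\<dots> = l * (1 - b) - a"
    using l(1) by (simp add: algebra_simps)
  finally have total: "sum f \<B> = l * (1 - b) - a" .
  \<comment> \<open>This form shows the sign of the total, since \<open>0 < l\<close>,
    \<open>l \<le> 1\<close> and \<open>a \<le> 0\<close>.\<close>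
  have "l * (1 - b) - a = l * (1 - (a + b)) - (1 - l) * a"
    by (simp add: algebra_simps)
  moreover have "0 \<le> l * (1 - (a + b))" using l(2) ab_le by simp
  moreover have "(1 - l) * a \<le> 0" using l1 a_nonpos by (simp add: mult_nonneg_nonpos)
  ultimately have "0 \<le> sum f \<B>" using total by linarith
  \<comment> \<open>The inequality of \<open>lower_ext_leD\<close>, rearranged, bounds
    \<open>f B\<close> by \<open>l * (1 - b) - a\<close>, which is the total.\<close>
  moreover have "f B \<le> sum f \<B>" if "B \<in> \<B>" for B
    using lower_ext_leD[of A B l] dil LB that cell(1)[OF that] l(2) l1
    unfolding total by (simp add: f_def l_def[symmetric] algebra_simps)
  moreover have "lower_ext L A (\<Union>S) \<le> L A"
    if S: "S \<subseteq> \<B>" "S \<noteq> {}" "sum f S \<le> sum f \<B>" for S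
  proof -
    let ?C = "\<Union>S"
    obtain B where B: "B \<in> S" "B \<in> \<B>" "B \<subseteq> ?C" using S by blast
    have "(A \<inter> ?C) \<inter> (- A \<inter> ?C) = {}" "- A \<inter> ?C \<noteq> {}"
      using B(3) cell(2)[OF B(2)] by blast+
    \<comment> \<open>This \<open>P\<close> gives \<open>?C\<close> exactly the mass
      \<open>b * P0 ?C + 1 - b\<close> of \<open>lower_ext_leD\<close>, so the bound on
      \<open>sum f S\<close> is sufficient as well.\<close>
    then obtain P where P: "P \<in> credal_set L" "P (A \<inter> ?C) = b * P0 (A \<inter> ?C) + a"
      "P (- A \<inter> ?C) = b * P0 (- A \<inter> ?C) + (1 - (a + b))"
      using credal_attains_bounds[OF union[OF B(2,3)]] by blast
    have "fa_prob P" using P(1) by (simp add: credal_set_def)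
    from fa_prob_split[OF this, of ?C A] fa_prob_split[OF P0, of ?C A] P(2,3)
    have PC: "P ?C = b * P0 ?C + 1 - b" by (simp add: algebra_simps)
    have PC_pos: "0 < P ?C"
      using credal_pos[OF P(1) _ B(3)] LB B(2) by simp
    have "P (A \<inter> ?C) \<le> l * P ?C"
      using S(3) sum_f[OF S(1)] total by (simp add: PC P(2) algebra_simps)
    with PC_pos have "P (A \<inter> ?C) / P ?C \<le> l" by (simp add: divide_le_eq)
    with lower_ext_le[OF conditional_pairs_conditional[OF P(1) PC_pos], of A]
    show ?thesis by (simp add: l_def)
  qed
  ultimately show ?thesis by (intro exI[of _ f]) simp
qed

end

section \<open>A coarser weakly dilating partition\<close>

theorem theorem5p1:
  fixes L U :: "'w set \<Rightarrow> real" and \<B> :: "'w set set" and A :: "'w set"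
  assumes "vertical_barrier_model L U"
    and "partition_on UNIV \<B>" and "finite \<B>" and "card \<B> \<ge> 3"
    and "weakly_dilates L U \<B> A"
    and "\<not> extreme_event L U A"
    and "\<forall>B\<in>\<B>. L B > 0"
    and a: "L A = 0 \<or> (\<forall>B\<in>\<B>. L (A \<inter> B) > 0 \<and> U (- A \<inter> B) > 0)"
    and b: "U A = 1 \<or> (\<forall>B\<in>\<B>. L (- A \<inter> B) > 0 \<and> U (A \<inter> B) > 0)"
  shows "\<exists>\<B>'. partition_on UNIV \<B>' \<and> \<B>' \<noteq> {UNIV} \<and> coarser \<B>' \<B> \<and> \<B>' \<noteq> \<B> \<and>
           weakly_dilates L U \<B>' A"
proof -
  obtain P0 a b where "vbm P0 a b" and L: "L = vbm_lower P0 a b" and U: "U = vbm_upper P0 a b"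
    using assms(1) unfolding vertical_barrier_model_def vbm_def by (metis less_imp_le)
  then interpret vbm P0 a b by simp
  have compl: "U A = 1 - L (- A)"
    unfolding L U by (rule vbm_upper_compl)
  have "L {} = 0" "L UNIV = 1" "U {} = 0" "U UNIV = 1"
    using a_nonpos by (auto simp: L U vbm_lower_def vbm_upper_def fa_prob_empty fa_prob_UNIV P0)
  with assms(6) have "A \<noteq> UNIV" "A \<noteq> {}"
    by (auto simp: extreme_event_def)
  then have A: "A \<noteq> UNIV" "- A \<noteq> UNIV" by auto
  have "\<B> \<noteq> {}" using assms(4) by auto
  have ext_compl: "upper_ext L A C = 1 - lower_ext L (- A) C" if "B \<in> \<B>" "B \<subseteq> C" for B C
    using upper_ext_compl conditional_pairs_nonempty[of B C] that assms(7) L by blast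
  \<comment> \<open>Weak dilation splits into lower halves for \<open>A\<close> and
    \<open>- A\<close>; \<open>L A \<le> U A\<close> is read off at any one cell, so
    \<open>\<B> \<noteq> {}\<close> is used.\<close>
  have low: "\<forall>B\<in>\<B>. lower_ext L A B \<le> L A" and LU: "L A \<le> U A"
    and upp: "\<forall>B\<in>\<B>. lower_ext L (- A) B \<le> L (- A)"
    using assms(5) ext_compl[OF _ order_refl] \<open>\<B> \<noteq> {}\<close>
    by (fastforce simp: weakly_dilates_def compl)+
  obtain f :: "'w set \<Rightarrow> real" where f: "0 \<le> sum f \<B>" "\<forall>B\<in>\<B>. f B \<le> sum f \<B>"
    "\<forall>S\<subseteq>\<B>. S \<noteq> {} \<longrightarrow> sum f S \<le> sum f \<B> \<longrightarrow> lower_ext L A (\<Union>S) \<le> L A"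
    using additive_dilation_criterion[folded L U, OF assms(2,3) \<open>\<B> \<noteq> {}\<close> assms(7) A(1) low assms(8)]
    by (elim exE conjE) (rule that)
  have b': "L (- A) = 0 \<or> (\<forall>B\<in>\<B>. L (- A \<inter> B) > 0 \<and> U (- (- A) \<inter> B) > 0)"
    using assms(9) compl by auto
  obtain g :: "'w set \<Rightarrow> real" where g: "0 \<le> sum g \<B>" "\<forall>B\<in>\<B>. g B \<le> sum g \<B>"
    "\<forall>S\<subseteq>\<B>. S \<noteq> {} \<longrightarrow> sum g S \<le> sum g \<B> \<longrightarrow> lower_ext L (- A) (\<Union>S) \<le> L (- A)"
    using additive_dilation_criterion[folded L U, OF assms(2,3) \<open>\<B> \<noteq> {}\<close> assms(7) A(2) upp b']
    by (elim exE conjE) (rule that)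
  obtain S where S: "S \<subset> \<B>" "card S \<ge> 2" "sum f S \<le> sum f \<B>" "sum g S \<le> sum g \<B>"
    using merge_two_bounds[OF assms(3,4) f(1) f(2) g(1) g(2)] by blast
  then have "S \<noteq> {}" by auto
  then obtain B where B: "B \<in> \<B>" "B \<subseteq> \<Union>S" using S(1) by blast
  have "U A \<le> upper_ext L A (\<Union>S)"
    using g(3)[rule_format, of S] S(1,4) \<open>S \<noteq> {}\<close> ext_compl[OF B] compl by auto
  moreover have "lower_ext L A (\<Union>S) \<le> L A"
    using f(3)[rule_format, of S] S(1,3) \<open>S \<noteq> {}\<close> by auto
  \<comment> \<open>Only the merged cell is new; the others inherit their inequalities from
    \<open>\<B>\<close>.\<close>
  ultimately have "weakly_dilates L U (insert (\<Union>S) (\<B> - S)) A"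
    using assms(5) LU by (auto simp: weakly_dilates_def)
  with partition_on_merge[OF assms(2) S(1,2)] show ?thesis by blast
qed

end
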